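(* Let $a,b,d\ge 1$ be integers with $\gcd(a,b)=1$, let $\rho=dab(a+b)$, $B^{-}=(a-1)(a+b)-a(d-1)$, $\mathbf h=(b,-(a+b),a)$, and let $t>da$ be an integer with $\gcd(t,d)=1$ and $t>B^{-}$. For an integer $s$ let $$\mathcal S_{0,2}^{-}(s)=\{\mathbf v\in\mathcal O_s^{-}: v_1<a+b\},\qquad \mathcal S_{0,1}^{-}(s)=\{\mathbf v\in\mathcal O_s^{-}: v_2<a\}.$$ Then the maps $$\widehat\varphi_{0,2}^{-}:\mathcal S_{0,2}^{-}(t)\to\mathcal S_{0,2}^{-}(t+\rho),\quad\mathbf v\mapsto\varphi_{0,2}(\mathbf v)\qquad\text{and}\qquad\widehat\varphi_{0,1}^{-}:\mathcal S_{0,1}^{-}(t)\to\mathcal S_{0,1}^{-}(t+\rho),\quad\mathbf v\mapsto\varphi_{0,1}(\mathbf v)$$ are well-defined bijections that preserve irreducibility (an element is irreducible in $\mathcal O_t^{-}$ if and only if its image is irreducible in $\mathcal O_{t+\rho}^{-}$). Furthermore, there exist $\boldsymbol\xi\in\mathcal S_{0,1}^{-}(t)$ and $\boldsymbol\omega\in\mathcal S_{0,2}^{-}(t)$ with $\ell(\boldsymbol\xi)=\ell(\boldsymbol\omega)=-d$ such that $\xi_2<a$ is minimal among coordinates $v_2$, and $\omega_1<a+b$ is minimal among coordinates $v_1$, of elements $\mathbf v\in\mathcal O_t^{-}$ with $\ell(\mathbf v)=-d$. As such, $$\mathcal H(\mathcal O_{t+\rho}^{-})=\bigcup_{j\in\{1,2\}}\widehat\varphi_{0,j}^{-}\big(\mathcal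 H(\mathcal O_t^{-})\cap\mathcal S_{0,j}^{-}(t)\big)\ \cup\ \{\varphi_{0,1}(\boldsymbol\xi),\ \varphi_{0,1}(\boldsymbol\xi)+\mathbf h,\ \ldots,\ \varphi_{0,2}(\boldsymbol\omega)\},$$ and in particular $|\mathcal H(\mathcal O_{t+\rho}^{-})|=|\mathcal H(\mathcal O_t^{-})|+db$.
   Context: For an integer $s$, $\mathbb L_s=\{(v_0,v_1,v_2)\in\mathbb Z^3:(s-da)v_0+sv_1+(s+db)v_2=0\}$ and $\mathcal O_s^{-}=\{\mathbf v\in\mathbb L_s : v_1\ge 0,\ v_2\ge 0\}$ (coordinate $0$ is then automatically $\le 0$ when $s>da$). A nonzero element of $\mathcal O_s^{-}$ is irreducible if it is not a sum of two nonzero elements of $\mathcal O_s^{-}$; the Hilbert basis $\mathcal H(\mathcal O_s^{-})$ is the (finite) set of minimal generators of the additive monoid $\mathcal O_s^{-}$, i.e. its irreducible elements. With $\ell(\mathbf v)=v_0+v_1+v_2$ and standard basis vectors $\mathbf e_0,\mathbf e_1,\mathbf e_2$ (indexed by coordinates $0,1,2$), the linear maps $\varphi_{0,1},\varphi_{0,2}:\mathbb L_t\to\mathbb L_{t+\rho}$ are $\varphi_{0,1}(\mathbf v)=\mathbf v+b(a+b)\ell(\mathbf v)(\mathbf e_0-\mathbf e_1)$ and $\varphi_{0,2}(\mathbf v)=\mathbf v+ab\,\ell(\mathbf v)(\mathbf e_0-\mathbf e_2)$. The last set in the displayed formula is the set of all $\varphi_{0,1}(\boldsymbol\xi)+k\mathbf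 h$ with $0\le k\le m$, where $m$ is the integer with $\varphi_{0,1}(\boldsymbol\xi)+m\mathbf h=\varphi_{0,2}(\boldsymbol\omega)$.
   Formalization: The bound is taken as B^- = (a-1)(a+b) + a(d-1), with plus instead of the printed minus (stronger for d ≥ 2); as printed the claim fails for a=2, b=1, d=2, t=5, where no v in O_t^- has ℓ(v) = -d. *)

theory Defs
  imports "HOL-Analysis.Finite_Cartesian_Product" "HOL-Library.Numeral_Type"
begin

text \<open>
  Elements of \<open>\<int>\<^sup>3\<close> are rendered as \<^typ>\<open>int ^ 3\<close>. The index type \<open>3\<close> is the ring
  of integers modulo 3, so its three elements are \<open>0\<close>, \<open>1\<close>, \<open>2\<close> (the numeral \<open>3\<close> denotes
  the same index as \<open>0\<close>), and \<open>v $ 0\<close>, \<open>v $ 1\<close>, \<open>v $ 2\<close> are the coordinates in the usual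
  order. For the same reason \<open>vector [x, y, z]\<close> is avoided: it would put \<open>z\<close> at index \<open>0\<close>.
  The term \<open>axis i 1\<close> is the standard basis vector with index \<open>i\<close>, and \<open>*s\<close> is scalar
  multiplication.
\<close>

definition ell :: "int ^ 3 \<Rightarrow> int" where
  "ell v = v $ 0 + v $ 1 + v $ 2"

definition L_lat :: "int \<Rightarrow> int \<Rightarrow> int \<Rightarrow> int \<Rightarrow> (int ^ 3) set" where
  "L_lat a b d s = {v. (s - d * a) * v $ 0 + s * v $ 1 + (s + d * b) * v $ 2 = 0}"

definition O_minus :: "int \<Rightarrow> int \<Rightarrow> int \<Rightarrow> int \<Rightarrow> (int ^ 3) set" where
  "O_minus a b d s = {v \<in> L_lat a b d s. v $ 1 \<ge> 0 \<and> v $ 2 \<ge> 0}"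

text \<open>
  An element \<open>v\<close> of the lattice for \<open>s\<close> satisfies \<open>ell v = - d\<close> if and only if
  \<open>v $ 0 = - d - v $ 1 - v $ 2\<close> and \<open>a * v $ 1 + (a + b) * v $ 2 = s - d * a\<close>. The condition
  \<open>s > B_minus a b d\<close> says that \<open>s - d * a\<close> exceeds the Frobenius number
  \<open>(a - 1) * (a + b) - a\<close> of \<open>a\<close> and \<open>a + b\<close>, so that this has a solution with
  \<open>v $ 1 \<ge> 0\<close> and \<open>v $ 2 \<ge> 0\<close>. The sign of \<open>a * (d - 1)\<close> matters: with the bound
  \<open>(a - 1) * (a + b) - a * (d - 1)\<close> and \<open>a = 2\<close>, \<open>b = 1\<close>, \<open>d = 2\<close>, \<open>s = 5\<close> the equation
  would be \<open>2 * v $ 1 + 3 * v $ 2 = 1\<close>, which has no such solution.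
\<close>

definition B_minus :: "int \<Rightarrow> int \<Rightarrow> int \<Rightarrow> int" where
  "B_minus a b d = (a - 1) * (a + b) + a * (d - 1)"

definition S02_minus :: "int \<Rightarrow> int \<Rightarrow> int \<Rightarrow> int \<Rightarrow> (int ^ 3) set" where
  "S02_minus a b d s = {v \<in> O_minus a b d s. v $ 1 < a + b}"

definition S01_minus :: "int \<Rightarrow> int \<Rightarrow> int \<Rightarrow> int \<Rightarrow> (int ^ 3) set" where
  "S01_minus a b d s = {v \<in> O_minus a b d s. v $ 2 < a}"

definition irreducible_in :: "'a::monoid_add set \<Rightarrow> 'a \<Rightarrow> bool" where
  "irreducible_in M v \<longleftrightarrow>
     v \<in> M \<and> v \<noteq> 0 \<and> \<not> (\<exists>x\<in>M. \<exists>y\<in>M. x \<noteq> 0 \<and> y \<noteq> 0 \<and> v = x + y)"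

definition hilbert_basis :: "'a::monoid_add set \<Rightarrow> 'a set" where
  "hilbert_basis M = {v. irreducible_in M v}"

definition phi01 :: "int \<Rightarrow> int \<Rightarrow> int ^ 3 \<Rightarrow> int ^ 3" where
  "phi01 a b v = v + (b * (a + b) * ell v) *s (axis 0 1 - axis 1 1)"

definition phi02 :: "int \<Rightarrow> int \<Rightarrow> int ^ 3 \<Rightarrow> int ^ 3" where
  "phi02 a b v = v + (a * b * ell v) *s (axis 0 1 - axis 2 1)"

definition hvec :: "int \<Rightarrow> int \<Rightarrow> int ^ 3" where
  "hvec a b = b *s axis 0 1 + (- (a + b)) *s axis 1 1 + a *s axis 2 1"

end

theory Submission
  imports Defs "HOL-Analysis.Cartesian_Space"
begin

text \<open>
  Put \<open>c = a + b\<close> and \<open>N = s - d * a\<close>. Since \<open>d\<close> is coprime to \<open>N\<close>, the function \<open>ell\<close> takes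
  only multiples of \<open>d\<close> on \<open>O_minus a b d s\<close>; writing \<open>ell v = - d * n\<close> and \<open>x, y\<close> for the last two
  coordinates, the monoid becomes the set of nonnegative integer triples \<open>(n, x, y)\<close> with
  \<open>a * x + c * y = n * N\<close> (\<open>point_mem_iff\<close>, \<open>mem_cases\<close>). The level \<open>n\<close> is additive and is positive
  away from \<open>0\<close>. Adding \<open>hvec\<close> moves inside a level by \<open>(-c, a)\<close>, and since \<open>a\<close> and \<open>c\<close> are coprime,
  each level is a chain of such moves. Replacing \<open>s\<close> by \<open>s + \<rho>\<close> adds \<open>a * c * b * d\<close> to \<open>N\<close>;
  \<open>phi01\<close> and \<open>phi02\<close> compensate for this by adding \<open>c * b * d * n\<close> to \<open>x\<close>, respectively
  \<open>a * b * d * n\<close> to \<open>y\<close>, and keep the level.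

  The bound on \<open>s\<close> says that \<open>N\<close> exceeds the Frobenius number \<open>a * c - a - c\<close>. Consequently an
  integer solution of \<open>a * x + c * y = n * N\<close> with \<open>n \<ge> 1\<close> and \<open>y < a\<close> has \<open>x \<ge> 0\<close>, and one with
  \<open>x < c\<close> has \<open>y \<ge> 0\<close>. This makes \<open>phi01\<close> and \<open>phi02\<close> surjective onto the strips for \<open>s + \<rho>\<close>
  (\<open>phi01_bij\<close>, \<open>phi02_bij\<close>). A summand of an element of a strip lies in the strip, so whether
  such an element is irreducible is decided inside the strip, where an additive bijection preserves
  it (\<open>irreducible_in_transfer\<close>).

  The remaining irreducible elements are found by level. At level one everything is irreducible,
  and the chain is that from \<open>\<xi>\<close> to \<open>\<omega>\<close> (\<open>level_one_chain\<close>). At level two or more, an element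
  that lies in both strips or in neither has an element of level one below it, and therefore splits
  (\<open>level_one_below\<close>). So the Hilbert basis is the disjoint union of the whole of level one and of
  the irreducible elements of higher level in the two strips (\<open>hilbert_basis_decomposition\<close>). The
  passage from \<open>t\<close> to \<open>t + \<rho>\<close> preserves the size of both strip parts and makes the chain longer by
  \<open>d * b\<close>: one end has its last coordinate raised by \<open>a * b * d\<close>, in steps of \<open>a\<close>, while at the
  other end this coordinate is unchanged.
\<close>

section \<open>Two-variable linear equations\<close>

lemma ex_solution_mod:
  fixes a c n :: int
  assumes "a \<ge> 1" "coprime a c"
  obtains x y where "a * x + c * y = n" "0 \<le> y" "y < a"
proof -
  obtain u v where uv: "u * a + v * c = 1"
    using bezout_int[of a c] assms by auto
  define q r where "q = n * v div a" and "r = n * v mod a"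
  have div_mod: "a * q + r = n * v" by (simp add: q_def r_def)
  have "a * (n * u + c * q) + c * r = n * (u * a) + c * (a * q + r)"
    by (simp add: algebra_simps)
  also have "\<dots> = n * (u * a + v * c)" unfolding div_mod by (simp add: algebra_simps)
  finally have eq: "a * (n * u + c * q) + c * r = n" using uv by simp
  show thesis
    by (rule that[OF eq]) (use assms in \<open>auto simp: r_def\<close>)
qed

text \<open>
  If \<open>x \<le> -1\<close>, then \<open>a * x + c * y\<close> is at most \<open>- a + c * (a - 1)\<close>, which for coprime \<open>a\<close>
  and \<open>c\<close> is the Frobenius number.
\<close>

lemma frobenius_nonneg:
  fixes a c n x y :: int
  assumes "a \<ge> 1" "c \<ge> 0" "a * x + c * y = n" "y < a" "n > (a - 1) * c - a"
  shows "x \<ge> 0"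
proof (rule ccontr)
  assume "\<not> x \<ge> 0"
  then have "a * x \<le> a * (-1)" using assms(1) by (intro mult_left_mono) auto
  moreover have "c * y \<le> c * (a - 1)" using assms by (intro mult_left_mono) auto
  ultimately show False using assms by (simp add: algebra_simps)
qed

text \<open>
  Among the integer points of the line \<open>a * x1 + c * y1 = N\<close>, which are spaced by \<open>(-c, a)\<close>, take
  the one with \<open>x - c < x1 \<le> x\<close>. If it had \<open>y1 > y\<close>, then
  \<open>2 * N \<le> a * x + c * y \<le> N + a * c - a - c\<close>, against the Frobenius bound; so it lies below
  \<open>(x, y)\<close>, and only the signs of its coordinates are in question. For \<open>x < c\<close> and \<open>y < a\<close> both are
  nonnegative by the Frobenius bound. For \<open>x \<ge> c\<close> and \<open>y \<ge> a\<close> the first is nonnegative, and if the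
  second is negative, the point of the line with \<open>0 \<le> y1 < a\<close> serves instead. In the two mixed
  regions the statement fails in general: irreducible elements of level two or more live there.
\<close>

lemma level_one_below:
  fixes a c N n x y :: int
  assumes "a \<ge> 1" "c \<ge> 1" "coprime a c"
    and N: "N > (a - 1) * c - a" "N \<ge> 0"
    and n: "n \<ge> 2" and eq: "a * x + c * y = n * N"
    and nonneg: "x \<ge> 0" "y \<ge> 0" and region: "x < c \<longleftrightarrow> y < a"
  obtains x1 y1 where "a * x1 + c * y1 = N" "0 \<le> x1" "x1 \<le> x" "0 \<le> y1" "y1 \<le> y"
proof -
  have N': "N > (c - 1) * a - c" using N by (simp add: algebra_simps)
  have "coprime c a" using assms(3) by (simp add: coprime_commute)
  \<comment> \<open>The right-hand side is chosen so that the residue \<open>r\<close> modulo \<open>c\<close> is the offset of the wanted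
    abscissa from \<open>x - (c - 1)\<close>, the left end of the window of length \<open>c\<close> that ends at \<open>x\<close>.\<close>
  then obtain y0 r where r: "c * y0 + a * r = N - a * x + a * (c - 1)" "0 \<le> r" "r < c"
    using ex_solution_mod[of c a "N - a * x + a * (c - 1)"] assms(2) by blast
  define x1 where "x1 = x - (c - 1) + r"
  have on: "a * x1 + c * y0 = N" using r(1) by (simp add: x1_def algebra_simps)
  have x1: "x - c < x1" "x1 \<le> x" using r by (auto simp: x1_def)
  have y0: "y0 \<le> y"
  proof (rule ccontr)
    assume "\<not> y0 \<le> y"
    then have "c * (y + 1) \<le> c * y0" using assms(2) by (intro mult_left_mono) auto
    moreover have "a * x \<le> a * (x1 + c - 1)" using x1 assms(1) by (intro mult_left_mono) auto
    ultimately have "n * N < 2 * N" using on eq N by (simp add: algebra_simps)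
    moreover have "2 * N \<le> n * N" using n N by (intro mult_right_mono) auto
    ultimately show False by simp
  qed
  show thesis
  proof (cases "x < c")
    case True
    then have "y0 < a" using region y0 by simp
    then have "0 \<le> x1" using frobenius_nonneg[of a c x1 y0 N] on assms(1,2) N by simp
    moreover have "0 \<le> y0"
      using frobenius_nonneg[of c a y0 x1 N] on assms(1,2) N' True x1 by (simp add: add.commute)
    ultimately show thesis using that on x1 y0 by blast
  next
    case False
    show thesis
    proof (cases "0 \<le> y0")
      case True
      then show thesis using that[of x1 y0] on x1 y0 False by simp
    next
      case y0neg: False
      obtain x2 y2 where p: "a * x2 + c * y2 = N" "0 \<le> y2" "y2 < a"
        using ex_solution_mod[of a c N] assms by blast
      have x2: "0 \<le> x2" using frobenius_nonneg[of a c x2 y2 N] p assms(1,2) N by simp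
      have "c * y0 \<le> c * y2" using p y0neg assms(2) by (intro mult_left_mono) auto
      then have "a * x2 \<le> a * x1" using on p by linarith
      then have "x2 \<le> x1" using assms(1) by (simp add: mult_le_cancel_left_pos)
      then show thesis using that[of x2 y2] p x1 x2 False region by simp
    qed
  qed
qed

section \<open>Irreducible elements and divisor-closed subsets\<close>

text \<open>
  A decomposition of an element of \<open>F\<close> in \<open>M\<close> takes place in \<open>F\<close>, because \<open>F\<close> contains the summands
  of its elements; the same holds for \<open>F'\<close> in \<open>M'\<close>. Hence \<open>f\<close> carries decompositions to
  decompositions in both directions. The strips to which this applies are not closed under
  addition, so \<open>f\<close> is additive and injective on the ambient group rather than on \<open>F\<close>.
\<close>

lemma irreducible_in_transfer:
  fixes f :: "'a::ab_group_add \<Rightarrow> 'a"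
  assumes bij: "bij_betw f F F'" and "inj f" and add: "\<And>x y. f (x + y) = f x + f y"
    and sub: "F \<subseteq> M" "F' \<subseteq> M'"
    and div: "\<And>x y. x \<in> M \<Longrightarrow> y \<in> M \<Longrightarrow> x + y \<in> F \<Longrightarrow> x \<in> F \<and> y \<in> F"
    and div': "\<And>x y. x \<in> M' \<Longrightarrow> y \<in> M' \<Longrightarrow> x + y \<in> F' \<Longrightarrow> x \<in> F' \<and> y \<in> F'"
    and v: "v \<in> F"
  shows "irreducible_in M v \<longleftrightarrow> irreducible_in M' (f v)"
proof -
  have f0: "f 0 = 0" using add[of 0 0] by simp
  have nz: "f x = 0 \<longleftrightarrow> x = 0" for x using f0 \<open>inj f\<close> by (metis injD)
  have fv: "f v \<in> F'" using bij v by (auto simp: bij_betw_def)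
  have "(\<exists>x\<in>M. \<exists>y\<in>M. x \<noteq> 0 \<and> y \<noteq> 0 \<and> v = x + y) \<longleftrightarrow>
        (\<exists>x\<in>M'. \<exists>y\<in>M'. x \<noteq> 0 \<and> y \<noteq> 0 \<and> f v = x + y)" (is "?L \<longleftrightarrow> ?R")
  proof
    assume ?L
    then obtain x y where xy: "x \<in> M" "y \<in> M" "x \<noteq> 0" "y \<noteq> 0" "v = x + y" by blast
    then have "x \<in> F" "y \<in> F" using div v by blast+
    then have "f x \<in> M'" "f y \<in> M'" using bij sub by (auto simp: bij_betw_def)
    then show ?R using xy add nz by blast
  next
    assume ?R
    then obtain x y where xy: "x \<in> M'" "y \<in> M'" "x \<noteq> 0" "y \<noteq> 0" "f v = x + y" by blast
    then have "x \<in> F'" "y \<in> F'" using div' fv by metis+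
    then obtain x' y' where p: "x' \<in> F" "y' \<in> F" "x = f x'" "y = f y'"
      using bij by (auto simp: bij_betw_def)
    then have "v = x' + y'" using xy add \<open>inj f\<close> by (metis injD)
    then show ?L using p xy sub f0 by (metis subsetD)
  qed
  then show ?thesis using v fv sub nz by (auto simp: irreducible_in_def)
qed

section \<open>Coordinates on the monoid\<close>

text \<open>
  The zeroth coordinate is the one that makes \<open>ell\<close> equal to \<open>- d * n\<close>, so that the level \<open>n\<close> can be
  carried along explicitly.
\<close>

definition point :: "int \<Rightarrow> int \<Rightarrow> int \<Rightarrow> int \<Rightarrow> int ^ 3" where
  "point d n x y = (\<chi> i. if i = 0 then - (d * n) - x - y else if i = 1 then x else y)"

lemma vec3_eq_iff: "(v::int ^ 3) = w \<longleftrightarrow> v $ 0 = w $ 0 \<and> v $ 1 = w $ 1 \<and> v $ 2 = w $ 2"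
proof -
  have "(3::3) = 0" by simp
  then have "i = 0 \<or> i = 1 \<or> i = 2" for i :: 3 using exhaust_3[of i] by metis
  then have "(\<forall>i. v $ i = w $ i) \<longleftrightarrow> v $ 0 = w $ 0 \<and> v $ 1 = w $ 1 \<and> v $ 2 = w $ 2"
    by metis
  then show ?thesis by (simp add: vec_eq_iff)
qed

lemma point_nth [simp]:
  "point d n x y $ 0 = - (d * n) - x - y" "point d n x y $ 1 = x" "point d n x y $ 2 = y"
  by (simp_all add: point_def)

lemma ell_point [simp]: "ell (point d n x y) = - (d * n)"
  by (simp add: ell_def)

lemma point_add: "point d n x y + point d n' x' y' = point d (n + n') (x + x') (y + y')"
  by (simp add: vec3_eq_iff algebra_simps)

lemma point_hvec: "point d n x y + k *s hvec a b = point d n (x - k * (a + b)) (y + k * a)"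
  by (simp add: vec3_eq_iff hvec_def axis_def algebra_simps)

lemma phi01_point: "phi01 a b (point d n x y) = point d n (x + b * (a + b) * (d * n)) y"
  by (simp add: vec3_eq_iff phi01_def axis_def algebra_simps)

lemma phi02_point: "phi02 a b (point d n x y) = point d n x (y + a * b * (d * n))"
  by (simp add: vec3_eq_iff phi02_def axis_def algebra_simps)

lemma point_0: "point d 0 0 0 = 0"
  by (simp add: vec3_eq_iff)

lemma point_eq_iff: "d \<noteq> 0 \<Longrightarrow> point d n x y = point d n' x' y' \<longleftrightarrow> n = n' \<and> x = x' \<and> y = y'"
  by (auto simp: vec3_eq_iff)

lemma ell_add: "ell (v + w) = ell v + ell w"
  by (simp add: ell_def)

lemma ell_phi [simp]: "ell (phi01 a b v) = ell v" "ell (phi02 a b v) = ell v"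
  by (simp_all add: ell_def phi01_def phi02_def axis_def)

lemma phi_add:
  "phi01 a b (v + w) = phi01 a b v + phi01 a b w"
  "phi02 a b (v + w) = phi02 a b v + phi02 a b w"
  by (simp_all add: vec3_eq_iff phi01_def phi02_def ell_add axis_def algebra_simps)

lemma inj_phi: "inj (phi01 a b)" "inj (phi02 a b)"
proof -
  show "inj (phi01 a b)"
  proof (rule injI)
    fix v w assume eq: "phi01 a b v = phi01 a b w"
    then have "ell v = ell w" by (metis ell_phi(1))
    then show "v = w" using eq by (simp add: phi01_def)
  qed
  show "inj (phi02 a b)"
  proof (rule injI)
    fix v w assume eq: "phi02 a b v = phi02 a b w"
    then have "ell v = ell w" by (metis ell_phi(2))
    then show "v = w" using eq by (simp add: phi02_def)
  qed
qed

text \<open>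
  The numerical hypotheses on \<open>t\<close> are inherited by \<open>t + \<rho>\<close>. Collecting them in a locale lets every
  result about a single monoid be used for both parameters.
\<close>

locale minus_cone =
  fixes a b d s :: int
  assumes a: "a \<ge> 1" and b: "b \<ge> 1" and d: "d \<ge> 1" and ab: "gcd a b = 1"
    and s: "s > d * a" and sd: "gcd s d = 1" and sB: "s > B_minus a b d"
begin

abbreviation "N \<equiv> s - d * a"
abbreviation "M \<equiv> O_minus a b d s"
abbreviation "S01 \<equiv> S01_minus a b d s"
abbreviation "S02 \<equiv> S02_minus a b d s"
abbreviation "level_one \<equiv> {v \<in> M. ell v = - d}"

lemma N_bound: "N > (a - 1) * (a + b) - a" "N > 0"
  using sB s by (auto simp: B_minus_def algebra_simps)

lemma N_bound': "N > ((a + b) - 1) * a - (a + b)"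
  using N_bound by (simp add: algebra_simps)

lemma coprime_ac: "coprime a (a + b)" "coprime (a + b) a"
  using ab by (simp_all add: coprime_iff_gcd_eq_1 gcd.commute)

lemma point_mem_iff:
  "point d n x y \<in> M \<longleftrightarrow> a * x + (a + b) * y = n * N \<and> 0 \<le> x \<and> 0 \<le> y"
proof -
  have "N * (- (d * n) - x - y) + s * x + (s + d * b) * y = d * (a * x + (a + b) * y - n * N)"
    by (simp add: algebra_simps)
  then show ?thesis using d by (auto simp: O_minus_def L_lat_def)
qed

text \<open>
  The lattice equation reads \<open>N * ell v = - d * (a * v $ 1 + (a + b) * v $ 2)\<close>, and \<open>d\<close> is coprime
  to \<open>N\<close>, so \<open>d\<close> divides \<open>ell v\<close>.
\<close>

lemma mem_cases:
  assumes "v \<in> M"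
  obtains n x y where "v = point d n x y" "a * x + (a + b) * y = n * N" "0 \<le> x" "0 \<le> y" "0 \<le> n"
proof -
  have eq: "N * v $ 0 + s * v $ 1 + (s + d * b) * v $ 2 = 0" and nn: "0 \<le> v $ 1" "0 \<le> v $ 2"
    using assms by (auto simp: O_minus_def L_lat_def)
  have "N * ell v = d * (- (a * v $ 1 + (a + b) * v $ 2))"
    using eq by (simp add: ell_def algebra_simps)
  then have "d dvd N * ell v" by simp
  moreover have "coprime d N"
  proof -
    have "k dvd s" if "k dvd d" "k dvd N" for k
      using dvd_add[OF that(2) dvd_mult2[OF that(1), of a]] by simp
    moreover have "coprime s d" using sd by (simp add: coprime_iff_gcd_eq_1)
    ultimately show ?thesis by (intro coprimeI) (metis coprime_common_divisor)
  qed
  ultimately have "d dvd ell v" by (simp add: coprime_dvd_mult_right_iff)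
  then obtain k where k: "ell v = d * k" by (elim dvdE)
  have v: "v = point d (- k) (v $ 1) (v $ 2)"
    using k by (simp add: vec3_eq_iff ell_def)
  then have sol: "a * v $ 1 + (a + b) * v $ 2 = (- k) * N" using assms point_mem_iff by metis
  moreover have "0 \<le> a * v $ 1 + (a + b) * v $ 2" using nn a b by simp
  ultimately have "0 \<le> - k" using N_bound(2) by (metis zero_le_mult_iff linorder_not_less)
  then show thesis using that v sol nn by blast
qed

lemma level_pos: "point d n x y \<in> M \<Longrightarrow> point d n x y \<noteq> 0 \<Longrightarrow> 1 \<le> n"
proof (rule ccontr)
  assume m: "point d n x y \<in> M" and nz: "point d n x y \<noteq> 0" and "\<not> 1 \<le> n"
  then have n: "n \<le> 0" by simp
  have sol: "a * x + (a + b) * y = n * N" "0 \<le> x" "0 \<le> y" using m point_mem_iff by auto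
  have "n * N \<le> 0" using n N_bound(2) by (simp add: mult_nonpos_nonneg)
  moreover have "0 \<le> a * x" "0 \<le> (a + b) * y" using sol a b by auto
  ultimately have "a * x = 0" "(a + b) * y = 0" "n * N = 0" using sol by linarith+
  then have "n = 0" "x = 0" "y = 0" using a b N_bound(2) by auto
  then show False using nz point_0 by simp
qed

lemma S01_divisor_closed: "v \<in> M \<Longrightarrow> w \<in> M \<Longrightarrow> v + w \<in> S01 \<Longrightarrow> v \<in> S01 \<and> w \<in> S01"
  by (auto simp: S01_minus_def O_minus_def)

lemma S02_divisor_closed: "v \<in> M \<Longrightarrow> w \<in> M \<Longrightarrow> v + w \<in> S02 \<Longrightarrow> v \<in> S02 \<and> w \<in> S02"
  by (auto simp: S02_minus_def O_minus_def)

section \<open>Irreducible elements by level\<close>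

text \<open>
  Nonzero elements have level at least one, and levels add up.
\<close>

lemma level_one_irreducible:
  assumes "v \<in> M" "ell v = - d"
  shows "irreducible_in M v"
proof -
  have False if xy: "x \<in> M" "y \<in> M" "x \<noteq> 0" "y \<noteq> 0" "v = x + y" for x y
  proof -
    obtain n p q where x: "x = point d n p q" using mem_cases[OF xy(1)] by metis
    obtain n' p' q' where y: "y = point d n' p' q'" using mem_cases[OF xy(2)] by metis
    have "1 \<le> n" "1 \<le> n'" using level_pos xy x y by auto
    moreover have "d * (n + n') = d * 1" using assms(2) xy(5) x y by (simp add: point_add)
    then have "n + n' = 1" using d by (metis mult_cancel_left not_one_le_zero)
    ultimately show False by simp
  qed
  moreover have "v \<noteq> 0" using assms d by (auto simp: ell_def)
  ultimately show ?thesis using assms by (auto simp: irreducible_in_def)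
qed

text \<open>
  In the excluded cases the element has \<open>x < a + b\<close> and \<open>y < a\<close>, or \<open>x \<ge> a + b\<close> and \<open>y \<ge> a\<close>, and
  an element of level one can be split off. That the strips share no irreducible element of higher
  level is what makes the two families add up without overlap in the count.
\<close>

lemma irreducible_higher_level:
  assumes "irreducible_in M v" "ell v \<noteq> - d"
  shows "v \<in> S01 \<longleftrightarrow> v \<notin> S02"
proof (rule ccontr)
  assume contra: "\<not> ?thesis"
  have v: "v \<in> M" "v \<noteq> 0" using assms by (auto simp: irreducible_in_def)
  obtain n x y where p: "v = point d n x y" "a * x + (a + b) * y = n * N" "0 \<le> x" "0 \<le> y"
    using mem_cases[OF v(1)] by metis
  have "1 \<le> n" using level_pos v p by auto
  then have n: "n \<ge> 2" using assms(2) p(1) by (cases "n = 1") auto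
  have "x < a + b \<longleftrightarrow> y < a" using contra v p(1) by (auto simp: S01_minus_def S02_minus_def)
  then obtain x1 y1 where q: "a * x1 + (a + b) * y1 = N" "0 \<le> x1" "x1 \<le> x" "0 \<le> y1" "y1 \<le> y"
    using level_one_below[of a "a + b" N n x y] a b coprime_ac N_bound n p by auto
  let ?u = "point d 1 x1 y1" and ?w = "point d (n - 1) (x - x1) (y - y1)"
  have "?u \<in> M" "?w \<in> M" using q p by (auto simp: point_mem_iff algebra_simps)
  moreover have "?u \<noteq> 0" "?w \<noteq> 0" using n d point_eq_iff[of d _ _ _ 0 0 0] by (auto simp: point_0)
  moreover have "v = ?u + ?w" using p by (simp add: point_add)
  ultimately show False using assms(1) by (auto simp: irreducible_in_def)
qed

text \<open>
  The monoid contains the points with \<open>(x, y)\<close> equal to \<open>(N, 0)\<close> and \<open>(0, N)\<close>, at levels \<open>a\<close> and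
  \<open>a + b\<close>. Subtracting one of them decomposes every element with a coordinate larger than \<open>N\<close>, so
  the irreducible elements are confined to a square.
\<close>

lemma finite_hilbert_basis: "finite (hilbert_basis M)"
proof -
  have "v \<in> (\<lambda>(x, y). point d ((a * x + (a + b) * y) div N) x y) ` ({0..N} \<times> {0..N})"
    if "irreducible_in M v" for v
  proof -
    have v: "v \<in> M" "v \<noteq> 0" using that by (auto simp: irreducible_in_def)
    obtain n x y where p: "v = point d n x y" "a * x + (a + b) * y = n * N" "0 \<le> x" "0 \<le> y"
      using mem_cases[OF v(1)] by metis
    have gens: "point d a N 0 \<in> M" "point d (a + b) 0 N \<in> M"
      using N_bound(2) by (auto simp: point_mem_iff)
    have gnz: "point d a N 0 \<noteq> 0" "point d (a + b) 0 N \<noteq> 0"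
      using a b d point_eq_iff[of d _ _ _ 0 0 0] by (auto simp: point_0)
    have "x \<le> N"
    proof (rule ccontr)
      assume "\<not> x \<le> N"
      let ?w = "point d (n - a) (x - N) y"
      have "?w \<in> M" using p \<open>\<not> x \<le> N\<close> by (simp add: point_mem_iff algebra_simps)
      moreover have "?w \<noteq> 0" using \<open>\<not> x \<le> N\<close> d point_eq_iff[of d _ _ _ 0 0 0] by (auto simp: point_0)
      moreover have "v = point d a N 0 + ?w" using p by (simp add: point_add)
      ultimately show False using that gens gnz by (auto simp: irreducible_in_def)
    qed
    moreover have "y \<le> N"
    proof (rule ccontr)
      assume "\<not> y \<le> N"
      let ?w = "point d (n - (a + b)) x (y - N)"
      have "?w \<in> M" using p \<open>\<not> y \<le> N\<close> by (simp add: point_mem_iff algebra_simps)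
      moreover have "?w \<noteq> 0" using \<open>\<not> y \<le> N\<close> d point_eq_iff[of d _ _ _ 0 0 0] by (auto simp: point_0)
      moreover have "v = point d (a + b) 0 N + ?w" using p by (simp add: point_add)
      ultimately show False using that gens gnz by (auto simp: irreducible_in_def)
    qed
    moreover have "n = (a * x + (a + b) * y) div N" using p(2) N_bound(2) by simp
    ultimately show ?thesis using p by force
  qed
  then have "hilbert_basis M \<subseteq> (\<lambda>(x, y). point d ((a * x + (a + b) * y) div N) x y) ` ({0..N} \<times> {0..N})"
    by (auto simp: hilbert_basis_def)
  then show ?thesis by (rule finite_subset) auto
qed

lemma level_one_S01:
  obtains \<xi> where "\<xi> \<in> S01" "ell \<xi> = - d"
proof -
  obtain x y where p: "a * x + (a + b) * y = N" "0 \<le> y" "y < a"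
    using ex_solution_mod a coprime_ac by metis
  then have "0 \<le> x" using frobenius_nonneg[of a "a + b" x y N] a b N_bound by auto
  then have "point d 1 x y \<in> S01" using p by (auto simp: S01_minus_def point_mem_iff)
  then show thesis using that[of "point d 1 x y"] by simp
qed

lemma level_one_S02:
  obtains \<omega> where "\<omega> \<in> S02" "ell \<omega> = - d"
proof -
  obtain x y where p: "(a + b) * y + a * x = N" "0 \<le> x" "x < a + b"
    using ex_solution_mod[of "a + b" a N] a b coprime_ac by auto
  then have "0 \<le> y" using frobenius_nonneg[of "a + b" a y x N] a b N_bound' by auto
  then have "point d 1 x y \<in> S02" using p by (auto simp: S02_minus_def point_mem_iff)
  then show thesis using that[of "point d 1 x y"] by simp
qed

lemma level_one_cases:
  assumes "v \<in> M" "ell v = - d"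
  obtains x y where "v = point d 1 x y" "a * x + (a + b) * y = N" "0 \<le> x" "0 \<le> y"
proof -
  obtain n x y where p: "v = point d n x y" "a * x + (a + b) * y = n * N" "0 \<le> x" "0 \<le> y"
    using mem_cases[OF assms(1)] by metis
  moreover have "d * n = d * 1" using assms(2) p(1) by simp
  then have "n = 1" using d by (metis mult_cancel_left not_one_le_zero)
  ultimately show thesis using that by simp
qed

text \<open>
  Two points of level one differ by a multiple of \<open>(-(a + b), a)\<close>, as \<open>a\<close> and \<open>a + b\<close> are coprime.
  The bound \<open>\<xi> $ 2 < a\<close> forbids a step backwards from \<open>\<xi>\<close>, and \<open>\<omega> $ 1 < a + b\<close> forbids a step
  beyond \<open>\<omega>\<close>.
\<close>

lemma level_one_chain:
  assumes \<xi>: "\<xi> \<in> S01" "ell \<xi> = - d" and \<omega>: "\<omega> \<in> S02" "ell \<omega> = - d"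
  obtains m where "0 \<le> m" "\<xi> + m *s hvec a b = \<omega>"
    "level_one = {\<xi> + k *s hvec a b | k. 0 \<le> k \<and> k \<le> m}"
proof -
  let ?c = "a + b"
  have "\<xi> \<in> M" "\<xi> $ 2 < a" "\<omega> \<in> M" "\<omega> $ 1 < ?c"
    using \<xi> \<omega> by (auto simp: S01_minus_def S02_minus_def)
  with \<xi> \<omega> obtain x y x' y' where
    p: "\<xi> = point d 1 x y" "a * x + ?c * y = N" "0 \<le> x" "0 \<le> y" "y < a" and
    q: "\<omega> = point d 1 x' y'" "a * x' + ?c * y' = N" "0 \<le> x'" "0 \<le> y'" "x' < ?c"
    by (smt (verit) level_one_cases point_nth)
  have step: "\<exists>k\<ge>0. u = x - k * ?c \<and> w = y + k * a" if uw: "a * u + ?c * w = N" "0 \<le> w" for u w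
  proof -
    have eq: "a * (x - u) = ?c * (w - y)" using p(2) uw by (simp add: algebra_simps)
    then have "a dvd ?c * (w - y)" by (metis dvd_triv_left)
    then have "a dvd w - y" using coprime_ac(1) by (simp add: coprime_dvd_mult_right_iff)
    then obtain k where k: "w - y = a * k" by (elim dvdE)
    then have "a * (x - u) = a * (?c * k)" using eq by (simp add: algebra_simps)
    then have "x - u = ?c * k" using a by simp
    \<comment> \<open>\<open>w \<ge> 0\<close> and \<open>y < a\<close> give \<open>w - y > - a\<close>\<close>
    moreover have "a * (-1) < a * k" using k uw p by simp
    then have "-1 < k" using a mult_less_cancel_left_pos[of a "-1" k] by linarith
    ultimately show ?thesis using k by (intro exI[of _ k]) (simp add: algebra_simps)
  qed
  obtain m where m: "0 \<le> m" "x' = x - m * ?c" "y' = y + m * a" using step q by metis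
  have "level_one = {\<xi> + k *s hvec a b | k. 0 \<le> k \<and> k \<le> m}"
  proof (intro equalityI subsetI)
    fix v assume "v \<in> level_one"
    then obtain u w where v: "v = point d 1 u w" "a * u + ?c * w = N" "0 \<le> u" "0 \<le> w"
      using level_one_cases by blast
    then obtain k where k: "0 \<le> k" "u = x - k * ?c" "w = y + k * a" using step by metis
    have "k * ?c < (m + 1) * ?c" using k m v(3) q(5) by (simp add: algebra_simps)
    then have "k \<le> m" using a b by (simp add: mult_less_cancel_right_pos)
    then show "v \<in> {\<xi> + k *s hvec a b | k. 0 \<le> k \<and> k \<le> m}"
      using v k p(1) by (auto simp: point_hvec)
  next
    fix v assume "v \<in> {\<xi> + k *s hvec a b | k. 0 \<le> k \<and> k \<le> m}"
    then obtain k where k: "0 \<le> k" "k \<le> m" and "v = \<xi> + k *s hvec a b" by blast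
    then have v: "v = point d 1 (x - k * ?c) (y + k * a)" using p(1) by (simp add: point_hvec)
    have "k * ?c \<le> m * ?c" using k a b by (intro mult_right_mono) auto
    then have "0 \<le> x - k * ?c" using m q by linarith
    moreover have "0 \<le> y + k * a" using k p a by simp
    moreover have "a * (x - k * ?c) + ?c * (y + k * a) = N" using p by (simp add: algebra_simps)
    ultimately show "v \<in> level_one" using v by (simp add: point_mem_iff)
  qed
  then show thesis using that m p(1) q(1) by (simp add: point_hvec)
qed

lemma card_chain:
  assumes "0 \<le> m"
  shows "int (card {\<xi> + k *s hvec a b | k. 0 \<le> k \<and> k \<le> m}) = m + 1"
proof -
  have "inj_on (\<lambda>k. \<xi> + k *s hvec a b) {0..m}"
    using a by (auto simp: inj_on_def vec3_eq_iff hvec_def axis_def)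
  then have "card ((\<lambda>k. \<xi> + k *s hvec a b) ` {0..m}) = card {0..m}" by (rule card_image)
  moreover have "{\<xi> + k *s hvec a b | k. 0 \<le> k \<and> k \<le> m} = (\<lambda>k. \<xi> + k *s hvec a b) ` {0..m}"
    by auto
  ultimately show ?thesis using assms by simp
qed

text \<open>
  Level one is removed so that the parts of the decomposition below are disjoint: the ends of the
  level-one chain lie in the strips.
\<close>

abbreviation "higher S \<equiv> {v \<in> hilbert_basis M \<inter> S. ell v \<noteq> - d}"

lemma hilbert_basis_decomposition:
  "hilbert_basis M = higher S01 \<union> higher S02 \<union> level_one"
  using irreducible_higher_level level_one_irreducible
  by (auto simp: hilbert_basis_def) (auto simp: irreducible_in_def)

lemma card_hilbert_basis:
  "card (hilbert_basis M) = card (higher S01) + card (higher S02) + card level_one"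
proof -
  have fin: "finite (higher S01)" "finite (higher S02)" "finite level_one"
    by (rule finite_subset[OF _ finite_hilbert_basis], use hilbert_basis_decomposition in blast)+
  have "higher S01 \<inter> higher S02 = {}"
    using irreducible_higher_level by (auto simp: hilbert_basis_def)
  moreover have "(higher S01 \<union> higher S02) \<inter> level_one = {}" by auto
  ultimately have "card (higher S01 \<union> higher S02 \<union> level_one)
      = card (higher S01) + card (higher S02) + card level_one"
    using fin by (simp add: card_Un_disjoint)
  then show ?thesis by (subst hilbert_basis_decomposition)
qed

end

section \<open>Passing from \<open>s\<close> to \<open>s + \<rho>\<close>\<close>

locale minus_cone_shift = minus_cone a b d t for a b d t :: int
begin

abbreviation "\<rho> \<equiv> d * a * b * (a + b)"

lemma minus_cone_shifted: "minus_cone a b d (t + \<rho>)"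
proof
  have "0 \<le> \<rho>" using a b d by simp
  then show "d * a < t + \<rho>" "B_minus a b d < t + \<rho>" using s sB by linarith+
  have "gcd (t + \<rho>) d = gcd t d"
    using gcd_add_mult[of d "a * b * (a + b)" t] by (simp add: gcd.commute algebra_simps)
  then show "gcd (t + \<rho>) d = 1" using sd by simp
qed (use a b d ab in auto)

end

sublocale minus_cone_shift \<subseteq> shifted: minus_cone a b d "t + d * a * b * (a + b)"
  by (rule minus_cone_shifted)

context minus_cone_shift
begin

text \<open>
  The map translates each level of the strip in the direction of \<open>x\<close>. For surjectivity, undoing the
  translation keeps \<open>y < a\<close> and yields a point on level \<open>n\<close> for \<open>t\<close>, whose first coordinate is
  nonnegative by the Frobenius bound; level \<open>0\<close>, where the bound does not apply, is not moved.
\<close>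

lemma phi01_bij: "bij_betw (phi01 a b) S01 shifted.S01"
proof (rule bij_betw_imageI)
  show "inj_on (phi01 a b) S01" using inj_phi(1) by (rule inj_on_subset) simp
  show "phi01 a b ` S01 = shifted.S01"
  proof (intro equalityI subsetI)
    fix w assume "w \<in> phi01 a b ` S01"
    then obtain v where v: "v \<in> M" "v $ 2 < a" "w = phi01 a b v"
      by (auto simp: S01_minus_def)
    obtain n x y where p: "v = point d n x y" "a * x + (a + b) * y = n * N" "0 \<le> x" "0 \<le> y" "0 \<le> n"
      using mem_cases[OF v(1)] by metis
    have "w = point d n (x + b * (a + b) * (d * n)) y"
      using v(3) p(1) by (simp add: phi01_point)
    moreover have "0 \<le> b * (a + b) * (d * n)" using a b d p by simp
    then have "0 \<le> x + b * (a + b) * (d * n)" using p by simp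
    moreover have "a * (x + b * (a + b) * (d * n)) + (a + b) * y = n * shifted.N"
      using p(2) by (simp add: algebra_simps)
    ultimately show "w \<in> shifted.S01"
      using v(2) p by (simp add: S01_minus_def shifted.point_mem_iff)
  next
    fix w assume "w \<in> shifted.S01"
    then have w: "w \<in> shifted.M" "w $ 2 < a" by (auto simp: S01_minus_def)
    obtain n x y where p: "w = point d n x y" "a * x + (a + b) * y = n * shifted.N"
        "0 \<le> x" "0 \<le> y" "0 \<le> n"
      using shifted.mem_cases[OF w(1)] by metis
    let ?x = "x - b * (a + b) * (d * n)"
    have eq: "a * ?x + (a + b) * y = n * N" using p(2) by (simp add: algebra_simps)
    have "0 \<le> ?x"
    proof (cases "n = 0")
      case True then show ?thesis using p by simp
    next
      case False
      then have "N \<le> n * N" using p N_bound(2) mult_right_mono[of 1 n N] by simp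
      then have "(a - 1) * (a + b) - a < n * N" by (rule order.strict_trans2[OF N_bound(1)])
      then show ?thesis
        using frobenius_nonneg[of a "a + b" ?x y "n * N"] eq w(2) p(1) a b by simp
    qed
    then have "point d n ?x y \<in> S01" using eq p w(2) by (simp add: S01_minus_def point_mem_iff)
    moreover have "w = phi01 a b (point d n ?x y)" using p(1) by (simp add: phi01_point)
    ultimately show "w \<in> phi01 a b ` S01" by blast
  qed
qed

text \<open>
  The mirror image of the preceding argument, with the other form of the Frobenius bound.
\<close>

lemma phi02_bij: "bij_betw (phi02 a b) S02 shifted.S02"
proof (rule bij_betw_imageI)
  show "inj_on (phi02 a b) S02" using inj_phi(2) by (rule inj_on_subset) simp
  show "phi02 a b ` S02 = shifted.S02"
  proof (intro equalityI subsetI)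
    fix w assume "w \<in> phi02 a b ` S02"
    then obtain v where v: "v \<in> M" "v $ 1 < a + b" "w = phi02 a b v"
      by (auto simp: S02_minus_def)
    obtain n x y where p: "v = point d n x y" "a * x + (a + b) * y = n * N" "0 \<le> x" "0 \<le> y" "0 \<le> n"
      using mem_cases[OF v(1)] by metis
    have "w = point d n x (y + a * b * (d * n))"
      using v(3) p(1) by (simp add: phi02_point)
    moreover have "0 \<le> a * b * (d * n)" using a b d p by simp
    then have "0 \<le> y + a * b * (d * n)" using p by simp
    moreover have "a * x + (a + b) * (y + a * b * (d * n)) = n * shifted.N"
      using p(2) by (simp add: algebra_simps)
    ultimately show "w \<in> shifted.S02"
      using v(2) p by (simp add: S02_minus_def shifted.point_mem_iff)
  next
    fix w assume "w \<in> shifted.S02"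
    then have w: "w \<in> shifted.M" "w $ 1 < a + b" by (auto simp: S02_minus_def)
    obtain n x y where p: "w = point d n x y" "a * x + (a + b) * y = n * shifted.N"
        "0 \<le> x" "0 \<le> y" "0 \<le> n"
      using shifted.mem_cases[OF w(1)] by metis
    let ?y = "y - a * b * (d * n)"
    have eq: "a * x + (a + b) * ?y = n * N" using p(2) by (simp add: algebra_simps)
    have "0 \<le> ?y"
    proof (cases "n = 0")
      case True then show ?thesis using p by simp
    next
      case False
      then have "N \<le> n * N" using p N_bound(2) mult_right_mono[of 1 n N] by simp
      then have "(a + b - 1) * a - (a + b) < n * N" by (rule order.strict_trans2[OF N_bound'])
      then show ?thesis
        using frobenius_nonneg[of "a + b" a ?y x "n * N"] eq w(2) p(1) a b
        by (simp add: add.commute)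
    qed
    then have "point d n x ?y \<in> S02" using eq p w(2) by (simp add: S02_minus_def point_mem_iff)
    moreover have "w = phi02 a b (point d n x ?y)" using p(1) by (simp add: phi02_point)
    ultimately show "w \<in> phi02 a b ` S02" by blast
  qed
qed

lemma phi01_irreducible_iff:
  "v \<in> S01 \<Longrightarrow> irreducible_in M v \<longleftrightarrow> irreducible_in shifted.M (phi01 a b v)"
  by (rule irreducible_in_transfer[where M = M and M' = shifted.M and f = "phi01 a b",
        OF phi01_bij inj_phi(1) phi_add(1) _ _
        S01_divisor_closed shifted.S01_divisor_closed])
     (auto simp: S01_minus_def)

lemma phi02_irreducible_iff:
  "v \<in> S02 \<Longrightarrow> irreducible_in M v \<longleftrightarrow> irreducible_in shifted.M (phi02 a b v)"
  by (rule irreducible_in_transfer[where M = M and M' = shifted.M and f = "phi02 a b",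
        OF phi02_bij inj_phi(2) phi_add(2) _ _
        S02_divisor_closed shifted.S02_divisor_closed])
     (auto simp: S02_minus_def)

lemma phi01_hilbert_basis:
  "phi01 a b ` (hilbert_basis M \<inter> S01) = hilbert_basis shifted.M \<inter> shifted.S01"
  using bij_betw_imp_surj_on[OF phi01_bij, symmetric] phi01_irreducible_iff
  by (auto simp: hilbert_basis_def)

lemma phi02_hilbert_basis:
  "phi02 a b ` (hilbert_basis M \<inter> S02) = hilbert_basis shifted.M \<inter> shifted.S02"
  using bij_betw_imp_surj_on[OF phi02_bij, symmetric] phi02_irreducible_iff
  by (auto simp: hilbert_basis_def)

lemma card_higher_shifted:
  "card (shifted.higher shifted.S01) = card (higher S01)"
  "card (shifted.higher shifted.S02) = card (higher S02)"
proof -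
  have "shifted.higher shifted.S01 = phi01 a b ` higher S01"
    unfolding phi01_hilbert_basis[symmetric] by auto
  then show "card (shifted.higher shifted.S01) = card (higher S01)"
    by (simp add: card_image inj_on_subset[OF inj_phi(1)])
  have "shifted.higher shifted.S02 = phi02 a b ` higher S02"
    unfolding phi02_hilbert_basis[symmetric] by auto
  then show "card (shifted.higher shifted.S02) = card (higher S02)"
    by (simp add: card_image inj_on_subset[OF inj_phi(2)])
qed

lemma shifted_hilbert_basis:
  "hilbert_basis shifted.M =
     phi01 a b ` (hilbert_basis M \<inter> S01) \<union> phi02 a b ` (hilbert_basis M \<inter> S02) \<union> shifted.level_one"
  unfolding phi01_hilbert_basis phi02_hilbert_basis
  using shifted.hilbert_basis_decomposition by blast

text \<open>
  The images of \<open>\<xi>\<close> and \<open>\<omega>\<close> again have level one and lie in the strips for \<open>t + \<rho>\<close>, so they are the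
  ends of the chain there. Comparing last coordinates of the ends gives the new length.
\<close>

lemma level_one_extremes:
  obtains \<xi> \<omega> m where "\<xi> \<in> S01" "\<omega> \<in> S02" "ell \<xi> = - d" "ell \<omega> = - d"
    "\<And>v. v \<in> M \<Longrightarrow> ell v = - d \<Longrightarrow> \<xi> $ 2 \<le> v $ 2"
    "\<And>v. v \<in> M \<Longrightarrow> ell v = - d \<Longrightarrow> \<omega> $ 1 \<le> v $ 1"
    "0 \<le> m" "phi01 a b \<xi> + m *s hvec a b = phi02 a b \<omega>"
    "shifted.level_one = {phi01 a b \<xi> + k *s hvec a b | k. 0 \<le> k \<and> k \<le> m}"
    "int (card shifted.level_one) = int (card level_one) + d * b"
proof -
  obtain \<xi> where \<xi>: "\<xi> \<in> S01" "ell \<xi> = - d" by (rule level_one_S01)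
  obtain \<omega> where \<omega>: "\<omega> \<in> S02" "ell \<omega> = - d" by (rule level_one_S02)
  obtain m where m: "0 \<le> m" "\<xi> + m *s hvec a b = \<omega>"
    and chain: "level_one = {\<xi> + k *s hvec a b | k. 0 \<le> k \<and> k \<le> m}"
    by (rule level_one_chain[OF \<xi> \<omega>])
  have \<xi>': "phi01 a b \<xi> \<in> shifted.S01" and \<omega>': "phi02 a b \<omega> \<in> shifted.S02"
    using phi01_bij phi02_bij \<xi> \<omega> by (auto simp: bij_betw_def)
  obtain m' where m': "0 \<le> m'" "phi01 a b \<xi> + m' *s hvec a b = phi02 a b \<omega>"
    and chain': "shifted.level_one = {phi01 a b \<xi> + k *s hvec a b | k. 0 \<le> k \<and> k \<le> m'}"
    by (rule shifted.level_one_chain[OF \<xi>' _ \<omega>']) (simp_all add: \<xi> \<omega>)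
  have min: "\<xi> $ 2 \<le> v $ 2 \<and> \<omega> $ 1 \<le> v $ 1" if v: "v \<in> M" "ell v = - d" for v
  proof -
    have "v \<in> level_one" using v by simp
    then obtain k where k: "0 \<le> k" "k \<le> m" "v = \<xi> + k *s hvec a b" unfolding chain by blast
    have "k * (a + b) \<le> m * (a + b)" "0 \<le> k * a" using k a b by (auto intro: mult_right_mono)
    then show ?thesis using k(3) m(2)[symmetric] by (simp add: hvec_def axis_def algebra_simps)
  qed
  have "(\<xi> + m *s hvec a b) $ 2 = \<omega> $ 2"
    "(phi01 a b \<xi> + m' *s hvec a b) $ 2 = phi02 a b \<omega> $ 2" using m m' by auto
  then have "a * m' = a * (m + d * b)"
    by (simp add: hvec_def axis_def phi01_def phi02_def \<omega> algebra_simps)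
  then have "m' = m + d * b" using a by simp
  then have "int (card shifted.level_one) = int (card level_one) + d * b"
    unfolding chain chain' using card_chain[OF m(1)] card_chain[OF m'(1)] by simp
  then show thesis using min by (intro that[OF \<xi>(1) \<omega>(1) \<xi>(2) \<omega>(2) _ _ m' chain']) simp_all
qed

end

theorem theorem5p1:
  fixes a b d t \<rho> :: int
  assumes "a \<ge> 1" and "b \<ge> 1" and "d \<ge> 1" and "gcd a b = 1"
    and "\<rho> = d * a * b * (a + b)"
    and "t > d * a" and "gcd t d = 1" and "t > B_minus a b d"
  shows
    "bij_betw (phi02 a b) (S02_minus a b d t) (S02_minus a b d (t + \<rho>)) \<and>
     (\<forall>v \<in> S02_minus a b d t.
        irreducible_in (O_minus a b d t) v \<longleftrightarrow>
        irreducible_in (O_minus a b d (t + \<rho>)) (phi02 a b v)) \<and>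
     bij_betw (phi01 a b) (S01_minus a b d t) (S01_minus a b d (t + \<rho>)) \<and>
     (\<forall>v \<in> S01_minus a b d t.
        irreducible_in (O_minus a b d t) v \<longleftrightarrow>
        irreducible_in (O_minus a b d (t + \<rho>)) (phi01 a b v)) \<and>
     (\<exists>\<xi> \<in> S01_minus a b d t. \<exists>\<omega> \<in> S02_minus a b d t.
        ell \<xi> = - d \<and> ell \<omega> = - d \<and>
        (\<forall>v \<in> O_minus a b d t. ell v = - d \<longrightarrow> \<xi> $ 2 \<le> v $ 2) \<and>
        (\<forall>v \<in> O_minus a b d t. ell v = - d \<longrightarrow> \<omega> $ 1 \<le> v $ 1) \<and>
        (\<exists>m \<ge> 0. phi01 a b \<xi> + m *s hvec a b = phi02 a b \<omega> \<and>
           hilbert_basis (O_minus a b d (t + \<rho>)) =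
             phi01 a b ` (hilbert_basis (O_minus a b d t) \<inter> S01_minus a b d t) \<union>
             phi02 a b ` (hilbert_basis (O_minus a b d t) \<inter> S02_minus a b d t) \<union>
             {phi01 a b \<xi> + k *s hvec a b | k. 0 \<le> k \<and> k \<le> m})) \<and>
     finite (hilbert_basis (O_minus a b d t)) \<and>
     finite (hilbert_basis (O_minus a b d (t + \<rho>))) \<and>
     int (card (hilbert_basis (O_minus a b d (t + \<rho>)))) =
       int (card (hilbert_basis (O_minus a b d t))) + d * b"
proof -
  interpret minus_cone_shift a b d t
    using assms by unfold_locales auto
  obtain \<xi> \<omega> m where e: "\<xi> \<in> S01" "\<omega> \<in> S02" "ell \<xi> = - d" "ell \<omega> = - d"
    "\<And>v. v \<in> M \<Longrightarrow> ell v = - d \<Longrightarrow> \<xi> $ 2 \<le> v $ 2"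
    "\<And>v. v \<in> M \<Longrightarrow> ell v = - d \<Longrightarrow> \<omega> $ 1 \<le> v $ 1"
    "0 \<le> m" "phi01 a b \<xi> + m *s hvec a b = phi02 a b \<omega>"
    "shifted.level_one = {phi01 a b \<xi> + k *s hvec a b | k. 0 \<le> k \<and> k \<le> m}"
    "int (card shifted.level_one) = int (card level_one) + d * b"
    by (rule level_one_extremes) (rule that)
  have card: "int (card (hilbert_basis shifted.M)) = int (card (hilbert_basis M)) + d * b"
    using e(10) card_hilbert_basis shifted.card_hilbert_basis card_higher_shifted by linarith
  have exs: "\<exists>\<xi> \<in> S01. \<exists>\<omega> \<in> S02. ell \<xi> = - d \<and> ell \<omega> = - d \<and>
      (\<forall>v \<in> M. ell v = - d \<longrightarrow> \<xi> $ 2 \<le> v $ 2) \<and> (\<forall>v \<in> M. ell v = - d \<longrightarrow> \<omega> $ 1 \<le> v $ 1) \<and>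
      (\<exists>m \<ge> 0. phi01 a b \<xi> + m *s hvec a b = phi02 a b \<omega> \<and>
         hilbert_basis shifted.M =
           phi01 a b ` (hilbert_basis M \<inter> S01) \<union> phi02 a b ` (hilbert_basis M \<inter> S02) \<union>
           {phi01 a b \<xi> + k *s hvec a b | k. 0 \<le> k \<and> k \<le> m})"
    using e shifted_hilbert_basis by (intro bexI[of _ \<xi>] bexI[of _ \<omega>] conjI exI[of _ m]) simp_all
  show ?thesis
    unfolding assms(5)
    by (intro conjI ballI phi02_bij phi01_bij exs finite_hilbert_basis
        shifted.finite_hilbert_basis card)
       (erule phi02_irreducible_iff, erule phi01_irreducible_iff)
qed

end
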